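(* Let $n,K\in\mathbb{N}$. For a probability distribution $F$ on $\mathbb{R}$, let $(S_k)_{0\le k\le n}$ be a random walk with $S_0=0$, $S_k=\sum_{t=1}^kX_t$, $X_t$ i.i.d. with distribution $F$, and for $i=1,\dots,K$ let $(S_{k,i})_{0\le k\le n}$ be independent copies. Consider (possibly randomised) stopping rules $\boldsymbol r=(r_k)$ with $r_k$ based solely on the realised rewards $(S_1^+,\dots,S_k^+)$ and the sample data $D=(S_{t,i}^+)_{0\le t\le n,\,1\le i\le K}$, let $\tau(\boldsymbol r)$ be the induced stopping time, and define the $K$-sample finite-horizon prophet constant $$C_{n,K}:=\sup_{\boldsymbol r}\ \inf_{F}\ \frac{\mathbb{E}[S_{\tau(\boldsymbol r)}^+]}{\mathbb{E}[\max_{0\le k\le n}S_k]},$$ where the supremum is over all such stopping rules and the infimum over probability distributions $F$ on $\mathbb{R}$. Then for $n\ge 2K^2$, $$C_{n,K}<\left(\frac{K}{K+1}\right)^{K+1}+\frac{6+6H_K}{H_n},$$ where $H_m=\sum_{j=1}^m\frac1j$ is the $m$-th harmonic number.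
   Context: Notation: $x^+=\max\{0,x\}$. The infimum over $F$ is taken over those $F$ for which the ratio is well defined, i.e. $0<\mathbb{E}[\max_{0\le k\le n}S_k]<\infty$. A stopping rule with access to data $D$ is a family of measurable functions $r_k(d,z_1,\dots,z_k)\in[0,1]$, $1\le k\le n$, giving the probability of stopping at time $k$ given $D=d$, $S_1^+=z_1,\dots,S_k^+=z_k$, and not having stopped earlier. The induced stopping time is $\tau(\boldsymbol r)=\inf\{k\le n:U_k\le r_k(D,S_1^+,\dots,S_k^+)\}$, where $U_1,\dots,U_n$ are i.i.d. uniform on $(0,1)$ and independent of everything else; if the rule never stops, the reward is $0$. The rule does not depend on $F$. *)

theory Defs
  imports "HOL-Probability.Probability" "HOL-Library.Extended_Nat"
begin

definition walk :: "(nat \<Rightarrow> real) \<Rightarrow> nat \<Rightarrow> real" where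
  "walk x k = (\<Sum>t = 1..k. x t)"

text \<open>Realised rewards \<open>(S\<^sub>1\<^sup>+, \<dots>, S\<^sub>k\<^sup>+)\<close> for the increments \<open>x\<close>, as a point of
  the product space over \<open>{1..k}\<close>.\<close>

definition rewards :: "nat \<Rightarrow> (nat \<Rightarrow> real) \<Rightarrow> nat \<Rightarrow> real" where
  "rewards k x = (\<lambda>j\<in>{1..k}. max 0 (walk x j))"

text \<open>The sample data: \<open>y (t, i)\<close> is the \<open>t\<close>-th increment of the \<open>i\<close>-th sample walk.\<close>

definition sample_data :: "nat \<Rightarrow> nat \<Rightarrow> (nat \<times> nat \<Rightarrow> real) \<Rightarrow> nat \<times> nat \<Rightarrow> real" where
  "sample_data n K y = (\<lambda>(t, i)\<in>{0..n} \<times> {1..K}. max 0 (walk (\<lambda>s. y (s, i)) t))"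

text \<open>Rules are defined on all real data and rewards rather than on nonnegative ones only; they are
  only ever evaluated at nonnegative values, so this amounts to a measurable extension.\<close>

type_synonym rule = "nat \<Rightarrow> (nat \<times> nat \<Rightarrow> real) \<Rightarrow> (nat \<Rightarrow> real) \<Rightarrow> real"

definition stopping_rules :: "nat \<Rightarrow> nat \<Rightarrow> rule set" where
  "stopping_rules n K = {r. \<forall>k\<in>{1..n}.
     (\<lambda>(d, z). r k d z) \<in>
       (\<Pi>\<^sub>M p\<in>{0..n} \<times> {1..K}. (borel :: real measure)) \<Otimes>\<^sub>M
       (\<Pi>\<^sub>M j\<in>{1..k}. (borel :: real measure)) \<rightarrow>\<^sub>M borel \<and>
     (\<forall>d z. r k d z \<in> {0..1})}"

text \<open>The infimum is taken in \<^typ>\<open>enat\<close>, so it is \<open>\<infinity>\<close> if the rule never stops.\<close>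

definition stopping_index ::
    "nat \<Rightarrow> rule \<Rightarrow> (nat \<times> nat \<Rightarrow> real) \<Rightarrow> (nat \<Rightarrow> real) \<Rightarrow> (nat \<Rightarrow> real) \<Rightarrow> enat" where
  "stopping_index n r d x u = Inf (enat ` {k \<in> {1..n}. u k \<le> r k d (rewards k x)})"

definition stopped_reward :: "(nat \<Rightarrow> real) \<Rightarrow> enat \<Rightarrow> real" where
  "stopped_reward x \<tau> = (case \<tau> of enat k \<Rightarrow> max 0 (walk x k) | \<infinity> \<Rightarrow> 0)"

text \<open>The joint law of the increments of the walk, the increments of the \<open>K\<close> sample walks, and the
  randomisation variables \<open>U\<^sub>1, \<dots>, U\<^sub>n\<close>, all independent.\<close>

definition joint_law ::
    "nat \<Rightarrow> nat \<Rightarrow> real measure \<Rightarrow> ((nat \<Rightarrow> real) \<times> (nat \<times> nat \<Rightarrow> real) \<times> (nat \<Rightarrow> real)) measure" where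
  "joint_law n K F =
     (\<Pi>\<^sub>M t\<in>{1..n}. F) \<Otimes>\<^sub>M (\<Pi>\<^sub>M p\<in>{1..n} \<times> {1..K}. F) \<Otimes>\<^sub>M
     (\<Pi>\<^sub>M k\<in>{1..n}. uniform_measure lborel {0<..<1})"

text \<open>Both expectations are of nonnegative variables (\<open>S\<^sub>0 = 0\<close> bounds the maximum from below), hence
  are taken in \<^typ>\<open>ennreal\<close>.\<close>

definition expected_reward :: "nat \<Rightarrow> nat \<Rightarrow> rule \<Rightarrow> real measure \<Rightarrow> ennreal" where
  "expected_reward n K r F =
     (\<integral>\<^sup>+(x, y, u). ennreal (stopped_reward x (stopping_index n r (sample_data n K y) x u))
        \<partial>joint_law n K F)"

definition expected_max :: "nat \<Rightarrow> nat \<Rightarrow> real measure \<Rightarrow> ennreal" where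
  "expected_max n K F = (\<integral>\<^sup>+(x, y, u). ennreal (MAX k\<in>{0..n}. walk x k) \<partial>joint_law n K F)"

definition prophet_constant :: "nat \<Rightarrow> nat \<Rightarrow> ennreal" where
  "prophet_constant n K =
     (SUP r\<in>stopping_rules n K.
        INF F\<in>{F. real_distribution F \<and> 0 < expected_max n K F \<and> expected_max n K F < \<infinity>}.
          expected_reward n K r F / expected_max n K F)"

end

theory Submission imports Defs begin

text \<open>
  The hard instances are walks that rise by one in each step with probability \<open>p\<close> and otherwise drop
  by \<open>n\<close>, which makes all later rewards zero. Until the drop such a walk reads \<open>1, 2, 3, \<dots>\<close>, so the
  rewards tell the player nothing about \<open>p\<close>: a rule is merely a random stopping level, chosen from the
  lengths \<open>g\<^sub>1, \<dots>, g\<^sub>K\<close> of the initial runs of the samples. Stopping at level \<open>k\<close> is worth \<open>k p\<^sup>k\<close>,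
  while the expected maximum is at least \<open>p + p\<^sup>2 + \<dots> + p\<^sup>n\<close>. This is the problem of stopping a
  geometric lifetime of unknown scale after seeing \<open>K\<close> copies. In the scale-free continuous limit
  the best response is the mean of the samples, worth \<open>(K / (K + 1))\<^bsup>K+1\<^esup>\<close> of the optimum.

  If a rule guarantees the ratio \<open>c\<close>, then its expected reward is at least \<open>c (p + \<dots> + p\<^sup>n)\<close> for every
  \<open>p\<close>. Dividing by \<open>p\<close> and integrating over \<open>(0, 1)\<close> turns the right side into \<open>c H\<^sub>n\<close>; this is an
  average over \<open>p\<close> with the (almost scale-free) density \<open>(1 - p\<^sup>n) / (1 - p)\<close> and total mass \<open>H\<^sub>n\<close>.
  Now the integrand on the left is a polynomial in \<open>p\<close>, and the samples fall into two classes.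

  When every sample run ends before \<open>n\<close>, only the total length \<open>s\<close> matters. Stopping at \<open>k\<close> then
  integrates to a Beta function, and multiplied by the number of sample vectors with total \<open>s\<close> it is at
  most \<open>(K / (K + 1))\<^bsup>K+1\<^esup> / s\<close>, whatever \<open>k\<close> is (\<open>level_weight_le\<close>). Summing over \<open>s \<le> K n\<close> gives
  \<open>(K / (K + 1))\<^bsup>K+1\<^esup> H\<^bsub>K n\<^esub>\<close>, and \<open>H\<^bsub>K n\<^esub> \<le> H\<^sub>n + H\<^sub>K\<close>. The total \<open>s = 0\<close> adds at most \<open>1\<close>.
  When some run is still alive at time \<open>n\<close>, the crude bound \<open>k p\<^sup>k \<le> n p\<close> suffices: such samples
  have probability \<open>1 - (1 - p\<^sup>n)\<^sup>K\<close> and contribute at most \<open>H\<^sub>K\<close> (\<open>censored_has_integral\<close>).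
  Together, \<open>c H\<^sub>n \<le> 1 + (K / (K + 1))\<^bsup>K+1\<^esup> (H\<^sub>n + H\<^sub>K) + H\<^sub>K\<close> (\<open>average_ratio_le\<close>), and
  \<open>1 + (K / (K + 1))\<^bsup>K+1\<^esup> H\<^sub>K + H\<^sub>K < 6 + 6 H\<^sub>K\<close>.
\<close>

section \<open>Harmonic and Beta estimates\<close>

text \<open>If \<open>s\<close> is the total length of the samples and the player stops at \<open>k\<close>, then \<open>q = s / (s + k)\<close> turns the
  scale-free value of stopping into \<open>K (1 - q) q\<^sup>K\<close>. It is maximal at \<open>q = K / (K + 1)\<close>; measuring \<open>q\<close> in units of
  that maximiser reduces the inequality to Bernoulli's.\<close>

lemma stopping_fraction_le:
  fixes q :: real
  assumes "1 \<le> K" "0 < q"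
  shows "real K * (1 - q) * q ^ K \<le> (real K / (real K + 1)) ^ (K + 1)"
proof -
  \<comment> \<open>The maximum is attained at \<open>v = 1\<close>.\<close>
  define v where "v = q * (real K + 1) / real K"
  have v: "v > 0" and q: "q = v * real K / (real K + 1)"
    using assms by (auto simp: v_def)
  have "1 + real (K + 1) * (1 / v - 1) \<le> (1 + (1 / v - 1)) ^ (K + 1)"
    using v by (intro Bernoulli_inequality) auto
  then have "(1 + real (K + 1) * (1 / v - 1)) * v ^ (K + 1) \<le> (1 / v) ^ (K + 1) * v ^ (K + 1)"
    using v by (intro mult_right_mono) auto
  also have "(1 / v) ^ (K + 1) * v ^ (K + 1) = 1"
    using v by (simp flip: power_mult_distrib del: power_Suc)
  also have "(1 + real (K + 1) * (1 / v - 1)) * v ^ (K + 1)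
      = ((1 + real (K + 1) * (1 / v - 1)) * v) * v ^ K"
    by simp
  also have "(1 + real (K + 1) * (1 / v - 1)) * v = real K + 1 - real K * v"
    using v by (simp add: field_simps)
  finally have le1: "(real K + 1 - real K * v) * v ^ K \<le> 1" .
  have "real K * (1 - q) * q ^ K
      = (real K + 1 - real K * v) * v ^ K * (real K / (real K + 1)) ^ (K + 1)"
    unfolding q by (simp add: power_mult_distrib power_divide field_simps)
  also have "\<dots> \<le> 1 * (real K / (real K + 1)) ^ (K + 1)"
    by (intro mult_right_mono le1) auto
  finally show ?thesis by simp
qed

lemma fact_add_eq_prod: "(fact (m + k) :: real) = fact m * (\<Prod>j=1..k. real (m + j))"
  by (induction k) (auto simp: algebra_simps)

text \<open>The player's gain from stopping at \<open>t\<close> after samples of total length \<open>s\<close>, averaged over \<open>p\<close>; the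
  binomial coefficient counts the samples with that total. In the quotient of factorials all factors of
  the denominator but two pair up as \<open>(s + j) / (s + t + j)\<close> with \<open>j < K\<close>, and these increase in \<open>j\<close>. Replacing each by the last one,
  with \<open>s + K - 1\<close> instead of \<open>s\<close>, leaves the expression of \<open>stopping_fraction_le\<close>. This shift
  of \<open>s\<close> is absorbed by the two remaining factors, so the bound \<open>1 / s\<close> has no error term.\<close>

lemma level_weight_le:
  assumes K: "1 \<le> K" and s: "1 \<le> s" and t: "1 \<le> t"
  shows "real ((s + K - 1) choose s) * (real t * (fact (s + t - 1) * fact K / fact (s + t + K)))
    \<le> (real K / (real K + 1)) ^ (K + 1) / real s"
proof -
  obtain L where L: "K = Suc L" using K by (cases K) auto
  define q where "q = real (s + L) / real (s + L + t)"
  define P where "P = (\<Prod>j=1..L. real (s + j) / real (s + t + j))"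
  have q: "0 < q" using s by (simp add: q_def)
  have "real ((s + L) choose s) = fact (s + L) / (fact s * fact L)"
    using binomial_fact[of s "s + L", where 'a = real] by simp
  also have "\<dots> = (\<Prod>j=1..L. real (s + j)) / fact L"
    by (simp add: fact_add_eq_prod)
  finally have c1: "real ((s + L) choose s) = (\<Prod>j=1..L. real (s + j)) / fact L" .
  have "(fact (s + t) :: real) = real (s + t) * fact (s + t - 1)"
    using t by (simp add: fact_reduce)
  then have c2: "(fact (s + t + K) :: real)
      = real (s + t + K) * (real (s + t) * fact (s + t - 1) * (\<Prod>j=1..L. real (s + t + j)))"
    using fact_add_eq_prod[of "s + t" L] by (simp add: L add_ac)
  have pos: "(\<Prod>j=1..L. real (s + t + j)) > 0" "(fact (s + t - 1) :: real) > 0"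
    using s by (auto intro!: prod_pos)
  have "real ((s + K - 1) choose s) * (real t * (fact (s + t - 1) * fact K / fact (s + t + K)))
      = real K * real t * P / (real (s + t) * real (s + t + K))"
    unfolding c2 using c1 pos by (simp add: L P_def prod_dividef mult_ac)
  also have "P \<le> q ^ L"
  proof -
    have "P \<le> (\<Prod>j=1..L. q)"
      unfolding P_def q_def
    proof (intro prod_mono conjI)
      fix j assume "j \<in> {1..L}"
      then have "real t * real j \<le> real t * real L" by (intro mult_left_mono) auto
      then show "real (s + j) / real (s + t + j) \<le> real (s + L) / real (s + L + t)"
        using s by (simp add: divide_simps) (simp add: algebra_simps)
    qed auto
    then show ?thesis by simp
  qed
  also have "real K * real t * q ^ L / (real (s + t) * real (s + t + K))
      \<le> real K * real t * q ^ L / (real (s + t) * real (s + L + t))"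
    using s q by (intro divide_left_mono mult_left_mono mult_nonneg_nonneg mult_pos_pos) (auto simp: L)
  also have "\<dots> = real K * (1 - q) * q ^ K / (q * real (s + t))"
  proof -
    have "1 - q = real t / real (s + L + t)"
      using s by (simp add: q_def field_simps)
    then show ?thesis
      using q by (simp add: L mult_ac)
  qed
  also have "\<dots> \<le> (real K / (real K + 1)) ^ (K + 1) / (q * real (s + t))"
    using stopping_fraction_le[OF K q] q by (intro divide_right_mono) auto
  also have "\<dots> \<le> (real K / (real K + 1)) ^ (K + 1) / real s"
  proof (intro divide_left_mono)
    have "real s * real (s + L + t) \<le> real (s + L) * real (s + t)"
      by (simp add: algebra_simps)
    then show "real s \<le> q * real (s + t)"
      using s by (simp add: q_def divide_simps)
  qed (use s q in auto)
  finally show ?thesis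
    by (simp add: divide_right_mono mult_left_mono)
qed

lemma level_weight_zero_le:
  assumes "1 \<le> t"
  shows "real t * (fact (t - 1) * fact K / fact (t + K)) \<le> (1 :: real)"
proof -
  have "real t * (fact (t - 1) * fact K / fact (t + K)) = fact t * fact K / fact (t + K)"
    using assms by (simp add: fact_reduce)
  also have "\<dots> \<le> (1 :: real)"
  proof -
    have "(fact t * fact K :: nat) dvd fact (t + K)" by (rule fact_fact_dvd_fact)
    then have "(fact t * fact K :: nat) \<le> fact (t + K)" by (rule dvd_imp_le) simp
    then have "real (fact t * fact K) \<le> real (fact (t + K))" by (simp only: of_nat_le_iff)
    then show ?thesis by simp
  qed
  finally show ?thesis .
qed

lemma Beta_has_integral:
  "((\<lambda>p::real. p ^ m * (1 - p) ^ k) has_integral fact m * fact k / fact (m + k + 1)) {0..1}"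
proof (induction k arbitrary: m)
  case 0
  have "((\<lambda>p::real. p ^ m) has_integral (1 ^ Suc m / real (Suc m) - 0 ^ Suc m / real (Suc m))) {0..1}"
    by (rule fundamental_theorem_of_calculus)
      (auto intro!: derivative_eq_intros simp: has_real_derivative_iff_has_vector_derivative[symmetric]
        simp del: of_nat_Suc power_Suc)
  also have "1 ^ Suc m / real (Suc m) - 0 ^ Suc m / real (Suc m) = fact m * fact 0 / fact (m + 0 + 1)"
    by simp
  finally show ?case by simp
next
  case (Suc k)
  have "((\<lambda>p::real. p ^ m * (1 - p) ^ k - p ^ Suc m * (1 - p) ^ k) has_integral
      (fact m * fact k / fact (m + k + 1) - fact (Suc m) * fact k / fact (Suc m + k + 1))) {0..1}"
    by (intro has_integral_diff Suc.IH)
  also have "(\<lambda>p::real. p ^ m * (1 - p) ^ k - p ^ Suc m * (1 - p) ^ k) = (\<lambda>p. p ^ m * (1 - p) ^ Suc k)"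
    by (simp add: algebra_simps)
  also have "(fact m * fact k / fact (m + k + 1) - fact (Suc m) * fact k / fact (Suc m + k + 1) :: real)
      = fact m * fact (Suc k) / fact (m + Suc k + 1)"
    by (simp add: divide_simps) (simp add: algebra_simps)
  finally show ?case .
qed

text \<open>Each of the \<open>K\<close> further blocks of \<open>n\<close> terms contributes little: the \<open>j\<close>-th consists of terms below
  \<open>1 / (j n)\<close>, so it adds at most \<open>1 / j\<close>.\<close>

lemma harm_mult_le: "harm (Suc K * n) \<le> harm n + (harm K :: real)"
proof (induction K)
  case (Suc K)
  have step: "harm (m + j) \<le> harm m + real j / real m" if "m > 0" for m j
  proof (induction j)
    case (Suc j)
    have "inverse (real (Suc (m + j))) \<le> 1 / real m"
      using that by (simp add: field_simps)
    with Suc show ?case by (simp add: harm_Suc add_divide_distrib)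
  qed simp
  show ?case
  proof (cases "n = 0")
    case False
    have "harm (Suc (Suc K) * n) = (harm (Suc K * n + n) :: real)"
      by (simp add: add_ac)
    also have "\<dots> \<le> harm (Suc K * n) + real n / real (Suc K * n)"
      using False by (intro step) simp
    also have "real n / real (Suc K * n) = inverse (real (Suc K))"
      unfolding of_nat_mult using False by (simp add: inverse_eq_divide del: of_nat_Suc)
    finally show ?thesis using Suc by (simp add: harm_Suc)
  qed (simp add: harm_expand(1) harm_nonneg)
qed (simp add: harm_expand(1))

section \<open>Averaging the ratio over the parameter\<close>

text \<open>Listing the values of \<open>g\<close> reduces this to the count of lists of \<open>K\<close> natural numbers with sum \<open>s\<close>; it is only an
  inequality because the values of \<open>g\<close> are bounded by \<open>n\<close>.\<close>

lemma card_sum_eq_le: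
  "card {g \<in> {1..K} \<rightarrow>\<^sub>E {0..<n}. (\<Sum>i\<in>{1..K}. g i) = s} \<le> (s + K - 1) choose s"
proof -
  let ?L = "{l :: nat list. length l = K \<and> sum_list l = s}"
  have "finite ?L"
  proof (rule finite_subset)
    show "?L \<subseteq> {l. set l \<subseteq> {0..s} \<and> length l = K}"
      using member_le_sum_list by fastforce
  qed (auto intro: finite_lists_length_eq)
  moreover have "inj_on (\<lambda>g. map g [1..<Suc K])
      {g \<in> {1..K} \<rightarrow>\<^sub>E {0..<n}. (\<Sum>i\<in>{1..K}. g i) = s}"
  proof (rule inj_onI)
    fix g h :: "nat \<Rightarrow> nat"
    assume g: "g \<in> {g \<in> {1..K} \<rightarrow>\<^sub>E {0..<n}. (\<Sum>i\<in>{1..K}. g i) = s}"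
      and h: "h \<in> {g \<in> {1..K} \<rightarrow>\<^sub>E {0..<n}. (\<Sum>i\<in>{1..K}. g i) = s}"
      and eq: "map g [1..<Suc K] = map h [1..<Suc K]"
    have "g i = h i" if "i \<in> {1..K}" for i
      using eq that unfolding map_eq_conv
      by (simp del: upt_Suc)
    moreover have "g \<in> {1..K} \<rightarrow>\<^sub>E {0..<n}" "h \<in> {1..K} \<rightarrow>\<^sub>E {0..<n}"
      using g h by simp_all
    ultimately show "g = h" by (metis PiE_ext)
  qed
  moreover have "(\<lambda>g. map g [1..<Suc K]) ` {g \<in> {1..K} \<rightarrow>\<^sub>E {0..<n}. (\<Sum>i\<in>{1..K}. g i) = s} \<subseteq> ?L"
    by (auto simp: sum_list_distinct_conv_sum_set atLeastLessThanSuc_atLeastAtMost simp del: upt_Suc)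
  ultimately have "card {g \<in> {1..K} \<rightarrow>\<^sub>E {0..<n}. (\<Sum>i\<in>{1..K}. g i) = s} \<le> card ?L"
    by (intro card_inj_on_le)
  also have "card ?L = (s + K - 1) choose s" by (rule card_length_sum_list)
  finally show ?thesis .
qed

text \<open>The geometric law censored at \<open>n\<close>: the probability that the initial run of rises in \<open>n\<close> steps has
  length \<open>a\<close>, for \<open>a \<le> n\<close>.\<close>

definition run_prob :: "nat \<Rightarrow> real \<Rightarrow> nat \<Rightarrow> real" where
  "run_prob n p a = p ^ a * (if a < n then 1 - p else 1)"

lemma sum_run_prob_less: "(\<Sum>a\<in>{0..<n}. run_prob n p a) = 1 - p ^ n"
proof -
  have "(\<Sum>a\<in>{0..<m}. p ^ a * (1 - p)) = 1 - p ^ m" for m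
    by (induction m) (auto simp: algebra_simps)
  then show ?thesis by (simp add: run_prob_def)
qed

lemma sum_run_prob: "(\<Sum>a\<in>{0..n}. run_prob n p a) = 1"
proof -
  have "{0..n} = insert n {0..<n}" by auto
  then show ?thesis by (simp add: sum_run_prob_less) (simp add: run_prob_def)
qed

lemma run_prob_nonneg: "0 \<le> p \<Longrightarrow> p \<le> 1 \<Longrightarrow> 0 \<le> run_prob n p a"
  by (simp add: run_prob_def)

text \<open>Some run reaches \<open>n\<close> unless all \<open>K\<close> independent runs end earlier.\<close>

lemma sum_censored_prob:
  "(\<Sum>g\<in>({1..K} \<rightarrow>\<^sub>E {0..n}) - ({1..K} \<rightarrow>\<^sub>E {0..<n}). \<Prod>i\<in>{1..K}. run_prob n p (g i))
    = 1 - (1 - p ^ n) ^ K"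
proof -
  have sub: "({1..K} \<rightarrow>\<^sub>E {0..<n}) \<subseteq> ({1..K} \<rightarrow>\<^sub>E {0..n})"
    by (intro PiE_mono) auto
  have "(\<Sum>g\<in>{1..K} \<rightarrow>\<^sub>E {0..n}. \<Prod>i\<in>{1..K}. run_prob n p (g i)) = 1"
    by (subst prod_sum_PiE [symmetric]) (auto simp: sum_run_prob)
  moreover have "(\<Sum>g\<in>{1..K} \<rightarrow>\<^sub>E {0..<n}. \<Prod>i\<in>{1..K}. run_prob n p (g i)) = (1 - p ^ n) ^ K"
    by (subst prod_sum_PiE [symmetric]) (auto simp: sum_run_prob_less)
  ultimately show ?thesis
    using sub by (subst sum_diff) (auto intro: finite_PiE)
qed

text \<open>The integrand dominates \<open>n (1 - (1 - p\<^sup>n)\<^sup>K) = n p\<^sup>n \<Sum>\<^bsub>j<K\<^esub> (1 - p\<^sup>n)\<^sup>j\<close>, the contribution of samples with a censored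
  run. Its exponent \<open>n - 1\<close> makes every summand a derivative: under \<open>v = p\<^sup>n\<close> it becomes \<open>(1 - v)\<^sup>j\<close>.\<close>

lemma censored_has_integral:
  assumes "1 \<le> n"
  shows "((\<lambda>p::real. \<Sum>j<K. real n * p ^ (n - 1) * (1 - p ^ n) ^ j) has_integral harm K) {0..1}"
proof -
  have "((\<lambda>p::real. real n * p ^ (n - 1) * (1 - p ^ n) ^ j) has_integral 1 / real (Suc j)) {0..1}" for j
  proof -
    have "((\<lambda>p::real. real n * p ^ (n - 1) * (1 - p ^ n) ^ j) has_integral
        (- ((1 - 1 ^ n) ^ Suc j / real (Suc j)) - (- ((1 - 0 ^ n) ^ Suc j / real (Suc j))))) {0..1}"
      by (rule fundamental_theorem_of_calculus)
        (auto intro!: derivative_eq_intros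
          simp: has_real_derivative_iff_has_vector_derivative[symmetric] simp del: of_nat_Suc power_Suc)
    then show ?thesis using assms by (simp add: power_0_left)
  qed
  then have "((\<lambda>p::real. \<Sum>j<K. real n * p ^ (n - 1) * (1 - p ^ n) ^ j) has_integral
      (\<Sum>j<K. 1 / real (Suc j))) {0..1}"
    by (intro has_integral_sum) auto
  also have "(\<Sum>j<K. 1 / real (Suc j)) = harm K"
    by (induction K) (auto simp: harm_Suc harm_expand(1) inverse_eq_divide)
  finally show ?thesis .
qed

text \<open>The analytic core. Here \<open>w g k\<close> is the probability that the rule stops a still rising walk at \<open>k\<close> when the
  samples have initial runs \<open>g\<close>, and the premise says that the rule guarantees the ratio \<open>c\<close> for every \<open>p\<close>.\<close>

lemma average_ratio_le:
  fixes w :: "(nat \<Rightarrow> nat) \<Rightarrow> nat \<Rightarrow> real" and c :: real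
  assumes K: "1 \<le> K" and n: "1 \<le> n"
    and w: "\<And>g k. 0 \<le> w g k" "\<And>g. (\<Sum>k=1..n. w g k) \<le> 1"
    and le: "\<And>p. 0 < p \<Longrightarrow> p < 1 \<Longrightarrow> c * (\<Sum>k=1..n. p ^ k) \<le>
      (\<Sum>g\<in>{1..K} \<rightarrow>\<^sub>E {0..n}. (\<Prod>i\<in>{1..K}. run_prob n p (g i)) *
        (\<Sum>k=1..n. w g k * (real k * p ^ k)))"
  shows "c * harm n \<le> 1 + (real K / (real K + 1)) ^ (K + 1) * (harm n + harm K) + harm K"
proof -
  define \<gamma> where "\<gamma> = (real K / (real K + 1)) ^ (K + 1)"
  define G where "G = ({1..K} \<rightarrow>\<^sub>E {0..n})"
  define G0 where "G0 = ({1..K} \<rightarrow>\<^sub>E {0..<n})"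
  define \<sigma> :: "(nat \<Rightarrow> nat) \<Rightarrow> nat" where "\<sigma> g = (\<Sum>i\<in>{1..K}. g i)" for g
  define A :: "real \<Rightarrow> real" where
    "A p = (\<Sum>g\<in>G0. \<Sum>k=1..n. w g k * (real k * (p ^ (\<sigma> g + k - 1) * (1 - p) ^ K)))" for p
  define B :: "real \<Rightarrow> real" where "B p = (\<Sum>j<K. real n * p ^ (n - 1) * (1 - p ^ n) ^ j)" for p
  define \<beta> where "\<beta> s k = real k * (fact (s + k - 1) * fact K / fact (s + k + K))" for s k :: nat
  have fin: "finite G" "finite G0"
    by (auto simp: G_def G0_def intro: finite_PiE)
  have sub: "G0 \<subseteq> G"
    unfolding G_def G0_def by (intro PiE_mono) auto
  have \<gamma>: "0 \<le> \<gamma>" by (simp add: \<gamma>_def)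

  \<comment> \<open>The average is taken of the premise divided by \<open>p\<close>, so that its left side has powers \<open>0, \<dots>, n - 1\<close>.\<close>
  have pointwise: "(\<Sum>k=1..n. c * p ^ (k - 1)) \<le> A p + B p" if p: "0 < p" "p < 1" for p
  proof -
    have "p * (\<Sum>k=1..n. c * p ^ (k - 1)) = c * (\<Sum>k=1..n. p ^ k)"
      by (auto simp: sum_distrib_left power_eq_if intro!: sum.cong)
    also have "\<dots> \<le> (\<Sum>g\<in>G. (\<Prod>i\<in>{1..K}. run_prob n p (g i)) * (\<Sum>k=1..n. w g k * (real k * p ^ k)))"
      unfolding G_def by (rule le[OF p])
    also have "\<dots> = (\<Sum>g\<in>G0. (\<Prod>i\<in>{1..K}. run_prob n p (g i)) * (\<Sum>k=1..n. w g k * (real k * p ^ k)))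
        + (\<Sum>g\<in>G - G0. (\<Prod>i\<in>{1..K}. run_prob n p (g i)) * (\<Sum>k=1..n. w g k * (real k * p ^ k)))"
      using sum.subset_diff[OF sub fin(1)] by (simp add: add.commute)
    also have "(\<Sum>g\<in>G0. (\<Prod>i\<in>{1..K}. run_prob n p (g i)) * (\<Sum>k=1..n. w g k * (real k * p ^ k)))
        = p * A p"
      unfolding A_def sum_distrib_left
    proof (intro sum.cong refl)
      fix g k assume g: "g \<in> G0" and k: "k \<in> {1..n}"
      have "(\<Prod>i\<in>{1..K}. run_prob n p (g i)) = (\<Prod>i\<in>{1..K}. p ^ g i * (1 - p))"
        using g by (intro prod.cong) (auto simp: G0_def run_prob_def dest: PiE_mem)
      also have "\<dots> = p ^ \<sigma> g * (1 - p) ^ K"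
        by (simp add: prod.distrib \<sigma>_def power_sum)
      finally have *: "(\<Prod>i\<in>{1..K}. run_prob n p (g i)) = p ^ \<sigma> g * (1 - p) ^ K" .
      have "p ^ \<sigma> g * p ^ k = p * p ^ (\<sigma> g + k - 1)"
        using k by (simp flip: power_add power_Suc)
      then show "(\<Prod>i\<in>{1..K}. run_prob n p (g i)) * (w g k * (real k * p ^ k))
          = p * (w g k * (real k * (p ^ (\<sigma> g + k - 1) * (1 - p) ^ K)))"
        unfolding * by (simp add: mult_ac)
    qed
    also have "(\<Sum>g\<in>G - G0. (\<Prod>i\<in>{1..K}. run_prob n p (g i)) * (\<Sum>k=1..n. w g k * (real k * p ^ k)))
        \<le> (\<Sum>g\<in>G - G0. (\<Prod>i\<in>{1..K}. run_prob n p (g i)) * (real n * p))"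
    proof (intro sum_mono mult_left_mono prod_nonneg ballI run_prob_nonneg)
      fix g
      have "(\<Sum>k=1..n. w g k * (real k * p ^ k)) \<le> (\<Sum>k=1..n. w g k * (real n * p))"
      proof (intro sum_mono mult_left_mono mult_mono w(1))
        fix k assume "k \<in> {1..n}"
        then show "p ^ k \<le> p"
          using p power_decreasing[of 1 k p] by simp
      qed (use p in auto)
      also have "\<dots> = (\<Sum>k=1..n. w g k) * (real n * p)"
        by (simp add: sum_distrib_right)
      also have "\<dots> \<le> 1 * (real n * p)"
        using p w(2) by (intro mult_right_mono) auto
      finally show "(\<Sum>k=1..n. w g k * (real k * p ^ k)) \<le> real n * p" by simp
    qed (use p in auto)
    also have "\<dots> = p * (real n * (1 - (1 - p ^ n) ^ K))"
      unfolding G_def G0_def sum_distrib_right[symmetric] sum_censored_prob by simp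
    also have "\<dots> \<le> p * B p"
    proof (intro mult_left_mono)
      have "1 - (1 - p ^ n) ^ K = p ^ n * (\<Sum>j<K. (1 - p ^ n) ^ j)"
        using one_diff_power_eq[of "1 - p ^ n" K] by simp
      also have "real n * \<dots> = (\<Sum>j<K. real n * p ^ n * (1 - p ^ n) ^ j)"
        by (simp add: sum_distrib_left mult_ac)
      also have "\<dots> \<le> B p"
        unfolding B_def using p
        by (intro sum_mono mult_right_mono mult_left_mono power_decreasing) (auto simp: power_le_one)
      finally show "real n * (1 - (1 - p ^ n) ^ K) \<le> B p" .
    qed (use p in auto)
    finally have "p * (\<Sum>k=1..n. c * p ^ (k - 1)) \<le> p * (A p + B p)"
      by (simp add: algebra_simps)
    with p show ?thesis by simp
  qed

  have int_C: "((\<lambda>p. \<Sum>k=1..n. c * p ^ (k - 1)) has_integral c * harm n) {0..1}"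
  proof -
    have "((\<lambda>p. c * p ^ (k - 1)) has_integral c * inverse (real k)) {0..1}" if "k \<in> {1..n}" for k
      using has_integral_mult_right[OF Beta_has_integral[of "k - 1" 0], of c] that
      by (simp add: fact_reduce[of k] field_simps)
    then have "((\<lambda>p. \<Sum>k=1..n. c * p ^ (k - 1)) has_integral (\<Sum>k=1..n. c * inverse (real k))) {0..1}"
      by (intro has_integral_sum) auto
    then show ?thesis by (simp add: harm_def sum_distrib_left)
  qed
  have int_A: "(A has_integral (\<Sum>g\<in>G0. \<Sum>k=1..n. w g k * \<beta> (\<sigma> g) k)) {0..1}"
    unfolding A_def \<beta>_def
  proof (intro has_integral_sum fin has_integral_mult_right finite_atLeastAtMost)
    fix g k assume "k \<in> {1..n}"
    then show "((\<lambda>p::real. p ^ (\<sigma> g + k - 1) * (1 - p) ^ K) has_integral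
        fact (\<sigma> g + k - 1) * fact K / fact (\<sigma> g + k + K)) {0..1}"
      using Beta_has_integral[of "\<sigma> g + k - 1" K] by simp
  qed
  have "c * harm n \<le> (\<Sum>g\<in>G0. \<Sum>k=1..n. w g k * \<beta> (\<sigma> g) k) + harm K"
  proof (rule has_integral_le)
    show "((\<lambda>p. \<Sum>k=1..n. c * p ^ (k - 1)) has_integral c * harm n) {0<..<1}"
      using int_C by (simp only: has_integral_Icc_iff_Ioo)
    show "((\<lambda>p. A p + B p) has_integral (\<Sum>g\<in>G0. \<Sum>k=1..n. w g k * \<beta> (\<sigma> g) k) + harm K) {0<..<1}"
      using has_integral_add[OF int_A censored_has_integral[OF n, of K, folded B_def]]
      by (simp only: has_integral_Icc_iff_Ioo)
  qed (use pointwise in auto)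
  also have "(\<Sum>g\<in>G0. \<Sum>k=1..n. w g k * \<beta> (\<sigma> g) k) \<le> 1 + \<gamma> * harm (K * n)"
  proof -
    \<comment> \<open>The level \<open>s = 0\<close> is exceptional since \<open>\<gamma> / s\<close> is not available there.\<close>
    define M where "M s = (if s = 0 then 1 else \<gamma> / real s)" for s :: nat
    define N where "N s = real ((s + K - 1) choose s)" for s
    have N: "N s \<ge> 1" for s
    proof -
      have "(s + K - 1) choose s > 0" using K by (simp add: zero_less_binomial_iff)
      then have "1 \<le> (s + K - 1) choose s" by linarith
      then show ?thesis unfolding N_def by linarith
    qed
    have M: "M s \<ge> 0" for s using \<gamma> by (simp add: M_def)
    have \<beta>: "\<beta> s k \<le> M s / N s" if "k \<ge> 1" for s k
    proof (cases "s = 0")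
      case True
      then show ?thesis
        using level_weight_zero_le[OF that, of K] by (simp add: \<beta>_def M_def N_def)
    next
      case False
      then have "N s * \<beta> s k \<le> M s"
        using level_weight_le[OF K _ that, of s] by (simp add: \<beta>_def M_def N_def \<gamma>_def)
      then show ?thesis using N[of s] by (simp add: field_simps)
    qed
    have "(\<Sum>g\<in>G0. \<Sum>k=1..n. w g k * \<beta> (\<sigma> g) k) \<le> (\<Sum>g\<in>G0. M (\<sigma> g) / N (\<sigma> g))"
    proof (rule sum_mono)
      fix g
      have "(\<Sum>k=1..n. w g k * \<beta> (\<sigma> g) k) \<le> (\<Sum>k=1..n. w g k * (M (\<sigma> g) / N (\<sigma> g)))"
        by (intro sum_mono mult_left_mono w \<beta>) auto
      also have "\<dots> = (\<Sum>k=1..n. w g k) * (M (\<sigma> g) / N (\<sigma> g))"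
        by (rule sum_distrib_right [symmetric])
      also have "\<dots> \<le> 1 * (M (\<sigma> g) / N (\<sigma> g))"
        using M N[of "\<sigma> g"] by (intro mult_right_mono w) auto
      finally show "(\<Sum>k=1..n. w g k * \<beta> (\<sigma> g) k) \<le> M (\<sigma> g) / N (\<sigma> g)" by simp
    qed
    also have "\<dots> = (\<Sum>s\<in>{0..K * n}. \<Sum>g\<in>{g \<in> G0. \<sigma> g = s}. M (\<sigma> g) / N (\<sigma> g))"
    proof (rule sum.group[symmetric])
      show "\<sigma> ` G0 \<subseteq> {0..K * n}"
      proof clarsimp
        fix g assume g: "g \<in> G0"
        have "\<sigma> g \<le> (\<Sum>i\<in>{1..K}. n)"
          unfolding \<sigma>_def using g by (intro sum_mono) (auto simp: G0_def dest!: PiE_mem)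
        then show "\<sigma> g \<le> K * n" by simp
      qed
    qed (use fin in auto)
    also have "\<dots> \<le> (\<Sum>s\<in>{0..K * n}. M s)"
    proof (rule sum_mono)
      fix s
      have "(\<Sum>g\<in>{g \<in> G0. \<sigma> g = s}. M (\<sigma> g) / N (\<sigma> g)) = real (card {g \<in> G0. \<sigma> g = s}) * (M s / N s)"
        by simp
      also have "\<dots> \<le> N s * (M s / N s)"
        using card_sum_eq_le[of K n s] M N[of s]
        by (intro mult_right_mono) (auto simp: G0_def \<sigma>_def N_def)
      also have "\<dots> = M s" using N[of s] by simp
      finally show "(\<Sum>g\<in>{g \<in> G0. \<sigma> g = s}. M (\<sigma> g) / N (\<sigma> g)) \<le> M s" .
    qed
    also have "\<dots> = M 0 + (\<Sum>s=1..K * n. M s)"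
      by (simp add: sum.atLeast_Suc_atMost)
    also have "(\<Sum>s=1..K * n. M s) = \<gamma> * harm (K * n)"
      by (auto simp: M_def harm_def sum_distrib_left divide_inverse intro!: sum.cong)
    finally show ?thesis by (simp add: M_def)
  qed
  also have "\<gamma> * harm (K * n) \<le> \<gamma> * (harm n + harm K)"
  proof (intro mult_left_mono \<gamma>)
    obtain L where L: "K = Suc L" using K by (cases K) auto
    have "harm (Suc L * n) \<le> harm n + (harm L :: real)" by (rule harm_mult_le)
    also have "(harm L :: real) \<le> harm K" by (simp add: L harm_Suc)
    finally show "harm (K * n) \<le> harm n + (harm K :: real)" by (simp add: L)
  qed
  finally show ?thesis by (simp add: \<gamma>_def)
qed

section \<open>The rise-or-drop walk\<close>

text \<open>After a drop of size \<open>n\<close> the at most \<open>n - 1\<close> other steps cannot lift the walk above zero again, so every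
  reward from the drop onwards vanishes.\<close>

definition drop_law :: "nat \<Rightarrow> real \<Rightarrow> real measure" where
  "drop_law n p = distr (measure_pmf (bernoulli_pmf p)) borel (\<lambda>b. if b then 1 else - real n)"

lemma real_distribution_drop_law: "real_distribution (drop_law n p)"
  unfolding drop_law_def by (intro prob_space.real_distribution_distr prob_space_measure_pmf) auto

lemma prob_space_drop_law: "prob_space (drop_law n p)"
  using real_distribution_drop_law by (simp add: real_distribution_def)

lemma sets_drop_law [simp]: "sets (drop_law n p) = sets borel"
  by (simp add: drop_law_def)

lemma space_drop_law [simp]: "space (drop_law n p) = UNIV"
  by (simp add: drop_law_def)

lemma emeasure_drop_law:
  assumes "0 \<le> p" "p \<le> 1"
  shows "emeasure (drop_law n p) {1} = ennreal p"
    and "emeasure (drop_law n p) (- {1}) = ennreal (1 - p)"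
    and "emeasure (drop_law n p) UNIV = 1"
proof -
  have "(\<lambda>b. if b then 1 else - real n) -` {1} = {True}"
    and "(\<lambda>b. if b then 1 else - real n) -` (- {1}) = {False}"
    by (auto split: if_splits)
  then show "emeasure (drop_law n p) {1} = ennreal p"
    and "emeasure (drop_law n p) (- {1}) = ennreal (1 - p)"
    using assms by (simp_all add: drop_law_def emeasure_distr emeasure_pmf_single)
  show "emeasure (drop_law n p) UNIV = 1"
    using prob_space.emeasure_space_1[OF prob_space_drop_law, of n p] by simp
qed

lemma AE_drop_law: "AE x in drop_law n p. x \<in> {1, - real n}"
  unfolding drop_law_def by (subst AE_distr_iff) auto

lemma AE_PiM_drop_law:
  assumes "finite I"
  shows "AE x in (\<Pi>\<^sub>M i\<in>I. drop_law n p). \<forall>i\<in>I. x i \<in> {1, - real n}"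
proof -
  have "AE x in (\<Pi>\<^sub>M i\<in>I. drop_law n p). x i \<in> {1, - real n}" if "i \<in> I" for i
    using AE_PiM_component[of I "\<lambda>_. drop_law n p" i "\<lambda>x. x \<in> {1, - real n}"]
      prob_space_drop_law AE_drop_law that by auto
  with assms show ?thesis by (subst AE_finite_all) auto
qed

lemma emeasure_PiM_drop_law:
  assumes "finite I" "\<And>i. i \<in> I \<Longrightarrow> B i \<in> sets borel"
  shows "emeasure (\<Pi>\<^sub>M i\<in>I. drop_law n p) (Pi\<^sub>E I B) = (\<Prod>i\<in>I. emeasure (drop_law n p) (B i))"
proof -
  interpret product_prob_space "\<lambda>_. drop_law n p"
    using prob_space_drop_law by (rule product_prob_spaceI)
  show ?thesis using assms by (intro emeasure_PiM) auto
qed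

lemma AE_pair_fst_snd:
  assumes "sigma_finite_measure N"
  shows "AE x in M. P x \<Longrightarrow> AE z in M \<Otimes>\<^sub>M N. P (fst z)"
    and "AE y in N. Q y \<Longrightarrow> AE z in M \<Otimes>\<^sub>M N. Q (snd z)"
proof -
  interpret N: sigma_finite_measure N by fact
  show "AE z in M \<Otimes>\<^sub>M N. P (fst z)" if "AE x in M. P x"
  proof -
    from that obtain A where "A \<in> null_sets M" "{x \<in> space M. \<not> P x} \<subseteq> A"
      by (auto simp: eventually_ae_filter)
    then show ?thesis
      by (intro AE_I'[of "A \<times> space N"])
        (auto simp: null_sets_def N.emeasure_pair_measure_Times space_pair_measure)
  qed
  show "AE z in M \<Otimes>\<^sub>M N. Q (snd z)" if "AE y in N. Q y"
  proof -
    from that obtain A where "A \<in> null_sets N" "{x \<in> space N. \<not> Q x} \<subseteq> A"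
      by (auto simp: eventually_ae_filter)
    then show ?thesis
      by (intro AE_I'[of "space M \<times> A"])
        (auto simp: null_sets_def N.emeasure_pair_measure_Times space_pair_measure)
  qed
qed

abbreviation uniform_draws :: "nat \<Rightarrow> (nat \<Rightarrow> real) measure" where
  "uniform_draws n \<equiv> (\<Pi>\<^sub>M k\<in>{1..n}. uniform_measure lborel {0<..<1})"

lemma prob_space_uniform_draws: "prob_space (uniform_draws n)"
  by (intro prob_space_PiM prob_space_uniform_measure) auto

lemma prob_space_PiM_drop_law: "prob_space (\<Pi>\<^sub>M i\<in>I. drop_law n p)"
  by (intro prob_space_PiM prob_space_drop_law)

lemma emeasure_joint_law_Times:
  assumes "A \<in> sets (\<Pi>\<^sub>M t\<in>{1..n}. drop_law m p)"
    and "B \<in> sets (\<Pi>\<^sub>M q\<in>{1..n} \<times> {1..K}. drop_law m p)"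
    and "C \<in> sets (uniform_draws n)"
  shows "A \<times> B \<times> C \<in> sets (joint_law n K (drop_law m p))"
    and "emeasure (joint_law n K (drop_law m p)) (A \<times> B \<times> C)
    = emeasure (\<Pi>\<^sub>M t\<in>{1..n}. drop_law m p) A
      * (emeasure (\<Pi>\<^sub>M q\<in>{1..n} \<times> {1..K}. drop_law m p) B * emeasure (uniform_draws n) C)"
proof -
  interpret Y: prob_space "\<Pi>\<^sub>M q\<in>{1..n} \<times> {1..K}. drop_law m p"
    by (rule prob_space_PiM_drop_law)
  interpret U: prob_space "uniform_draws n"
    by (rule prob_space_uniform_draws)
  interpret YU: prob_space "(\<Pi>\<^sub>M q\<in>{1..n} \<times> {1..K}. drop_law m p) \<Otimes>\<^sub>M uniform_draws n"
    by (intro prob_space_pair Y.prob_space_axioms U.prob_space_axioms)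
  show "A \<times> B \<times> C \<in> sets (joint_law n K (drop_law m p))"
    using assms unfolding joint_law_def by (intro pair_measureI) auto
  show "emeasure (joint_law n K (drop_law m p)) (A \<times> B \<times> C)
    = emeasure (\<Pi>\<^sub>M t\<in>{1..n}. drop_law m p) A
      * (emeasure (\<Pi>\<^sub>M q\<in>{1..n} \<times> {1..K}. drop_law m p) B * emeasure (uniform_draws n) C)"
    using assms unfolding joint_law_def
    by (simp only: YU.emeasure_pair_measure_Times[OF assms(1) pair_measureI[OF assms(2,3)]]
        U.emeasure_pair_measure_Times[OF assms(2,3)])
qed

lemma prob_space_joint_law: "prob_space (joint_law n K (drop_law m p))"
  unfolding joint_law_def
  by (intro prob_space_pair prob_space_PiM_drop_law prob_space_uniform_draws)

lemma AE_joint_law: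
  "AE z in joint_law n K (drop_law m p).
    (\<forall>t\<in>{1..n}. fst z t \<in> {1, - real m}) \<and>
    (\<forall>q\<in>{1..n} \<times> {1..K}. fst (snd z) q \<in> {1, - real m})"
proof -
  have U: "sigma_finite_measure (uniform_draws n)"
    by (intro prob_space_imp_sigma_finite prob_space_uniform_draws)
  have YU: "sigma_finite_measure ((\<Pi>\<^sub>M q\<in>{1..n} \<times> {1..K}. drop_law m p) \<Otimes>\<^sub>M uniform_draws n)"
    by (intro prob_space_imp_sigma_finite prob_space_pair prob_space_PiM_drop_law
        prob_space_uniform_draws)
  have "AE z in joint_law n K (drop_law m p). \<forall>t\<in>{1..n}. fst z t \<in> {1, - real m}"
    unfolding joint_law_def by (intro AE_pair_fst_snd(1) YU AE_PiM_drop_law) auto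
  moreover have "AE z in joint_law n K (drop_law m p).
      \<forall>q\<in>{1..n} \<times> {1..K}. fst (snd z) q \<in> {1, - real m}"
    unfolding joint_law_def
    by (intro AE_pair_fst_snd(2)[OF YU] AE_pair_fst_snd(1)[OF U] AE_PiM_drop_law) auto
  ultimately show ?thesis by (rule AE_conjI)
qed

lemma initial_run:
  fixes z :: "nat \<Rightarrow> real"
  obtains a where "a \<le> n" "\<And>t. t \<in> {1..a} \<Longrightarrow> z t = 1" "a < n \<Longrightarrow> z (Suc a) \<noteq> 1"
proof -
  have "\<exists>a\<le>n. (\<forall>t\<in>{1..a}. z t = 1) \<and> (a < n \<longrightarrow> z (Suc a) \<noteq> 1)"
  proof (induction n)
    case (Suc n)
    then obtain a where a: "a \<le> n" "\<forall>t\<in>{1..a}. z t = 1" "a < n \<longrightarrow> z (Suc a) \<noteq> 1"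
      by blast
    show ?case
    proof (cases "a = n \<and> z (Suc n) = 1")
      case True
      then show ?thesis using a by (intro exI[of _ "Suc n"]) (auto simp: le_Suc_eq)
    next
      case False
      then show ?thesis using a by (intro exI[of _ a]) auto
    qed
  qed auto
  with that show ?thesis by blast
qed

lemma walk_up: "(\<And>t. t \<in> {1..k} \<Longrightarrow> x t = 1) \<Longrightarrow> walk x k = real k"
  by (simp add: walk_def)

text \<open>One drop of size \<open>n\<close> outweighs all of the other at most \<open>n - 1\<close> rises.\<close>

lemma walk_after_drop:
  assumes x: "\<And>t. t \<in> {1..n} \<Longrightarrow> x t \<in> {1, - real n}" and k: "k \<le> n"
    and s: "s \<in> {1..k}" "x s \<noteq> 1"
  shows "walk x k \<le> 0"
proof -
  have "walk x k = x s + (\<Sum>t\<in>{1..k} - {s}. x t)"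
    unfolding walk_def using s by (intro sum.remove) auto
  also have "x s = - real n" using x[of s] s k by auto
  also have "(\<Sum>t\<in>{1..k} - {s}. x t) \<le> (\<Sum>t\<in>{1..k} - {s}. 1)"
    using x k by (intro sum_mono) force
  also have "\<dots> \<le> real n" using s k by simp
  finally show ?thesis by simp
qed

lemma walk_le:
  assumes "\<And>t. t \<in> {1..n} \<Longrightarrow> x t \<in> {1, - real n}" and "k \<le> n"
  shows "walk x k \<le> real n"
proof -
  have "walk x k \<le> (\<Sum>t=1..k. 1)"
    unfolding walk_def using assms by (intro sum_mono) force
  with assms show ?thesis by simp
qed

section \<open>Probabilities of runs and of stopping\<close>

text \<open>The relevant events are boxes, that is, they constrain the coordinates one by one; so their
  probabilities are products. The first is the event that the walk rises up to time \<open>k\<close>, the second that the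
  samples have initial runs of lengths \<open>g\<close> (with no constraint on a drop after time \<open>n\<close>).\<close>

definition run_box :: "nat \<Rightarrow> nat \<Rightarrow> (nat \<Rightarrow> real) set" where
  "run_box n k = (\<Pi>\<^sub>E t\<in>{1..n}. if t \<le> k then {1} else UNIV)"

definition sample_box :: "nat \<Rightarrow> nat \<Rightarrow> (nat \<Rightarrow> nat) \<Rightarrow> (nat \<times> nat \<Rightarrow> real) set" where
  "sample_box n K g = (\<Pi>\<^sub>E (t, i)\<in>{1..n} \<times> {1..K}.
     if t \<le> g i then {1} else if t = Suc (g i) then - {1} else UNIV)"

definition run_data :: "nat \<Rightarrow> nat \<Rightarrow> (nat \<Rightarrow> nat) \<Rightarrow> nat \<times> nat \<Rightarrow> real" where
  "run_data n K g = (\<lambda>(t, i)\<in>{0..n} \<times> {1..K}. if t \<le> g i then real t else 0)"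

text \<open>The draws for which the rule stops at \<open>k\<close> when the walk keeps rising, that is, when it sees the
  rewards \<open>1, 2, \<dots>, k\<close>.\<close>

definition stop_event :: "nat \<Rightarrow> rule \<Rightarrow> (nat \<times> nat \<Rightarrow> real) \<Rightarrow> nat \<Rightarrow> (nat \<Rightarrow> real) set" where
  "stop_event n r d k = {u \<in> space (uniform_draws n). u k \<le> r k d (\<lambda>j\<in>{1..k}. real j) \<and>
     (\<forall>s\<in>{1..<k}. r s d (\<lambda>j\<in>{1..s}. real j) < u s)}"

lemma run_box_sets: "run_box n k \<in> sets (\<Pi>\<^sub>M t\<in>{1..n}. drop_law m p)"
  unfolding run_box_def by (intro sets_PiM_I_finite) auto

lemma sample_box_sets:
  "sample_box n K g \<in> sets (\<Pi>\<^sub>M q\<in>{1..n} \<times> {1..K}. drop_law m p)"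
  unfolding sample_box_def by (intro sets_PiM_I_finite) auto

lemma stop_event_sets:
  assumes "k \<in> {1..n}"
  shows "stop_event n r d k \<in> sets (uniform_draws n)"
proof -
  have m: "(\<lambda>u. u s) \<in> uniform_draws n \<rightarrow>\<^sub>M borel" if "s \<in> {1..k}" for s
    using measurable_component_singleton[of s "{1..n}" "\<lambda>_. uniform_measure lborel {0<..<1}"]
      that assms by (simp cong: measurable_cong_sets)
  have "{u \<in> space (uniform_draws n). u k \<le> r k d (\<lambda>j\<in>{1..k}. real j)} \<in> sets (uniform_draws n)"
    using assms by (intro borel_measurable_le m borel_measurable_const) auto
  moreover have "{u \<in> space (uniform_draws n). r s d (\<lambda>j\<in>{1..s}. real j) < u s} \<in> sets (uniform_draws n)"
    if "s \<in> {1..<k}" for s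
    using that by (intro borel_measurable_less m borel_measurable_const) auto
  ultimately show ?thesis
    unfolding stop_event_def
    by (intro sets.sets_Collect_conj sets.sets_Collect_finite_All) auto
qed

text \<open>A rule stops at most once, so the events for different \<open>k\<close> are disjoint.\<close>

lemma sum_measure_stop_event_le:
  "(\<Sum>k=1..n. measure (uniform_draws n) (stop_event n r d k)) \<le> 1"
proof -
  interpret U: prob_space "uniform_draws n" by (rule prob_space_uniform_draws)
  have "disjoint_family_on (stop_event n r d) {1..n}"
  proof (unfold disjoint_family_on_def, intro ballI impI)
    have "stop_event n r d j \<inter> stop_event n r d k = {}" if "j < k" "1 \<le> j" for j k
      using that by (force simp: stop_event_def)
    then show "stop_event n r d j \<inter> stop_event n r d k = {}"
      if "j \<in> {1..n}" "k \<in> {1..n}" "j \<noteq> k" for j k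
      using that by (cases j k rule: linorder_cases) fastforce+
  qed
  then have "(\<Sum>k=1..n. measure (uniform_draws n) (stop_event n r d k))
      = measure (uniform_draws n) (\<Union>k\<in>{1..n}. stop_event n r d k)"
    by (intro U.finite_measure_finite_Union[symmetric]) (use stop_event_sets in blast)+
  also have "\<dots> \<le> 1" by (rule U.prob_le_1)
  finally show ?thesis .
qed

lemma emeasure_run_box:
  assumes "0 \<le> p" "p \<le> 1" "k \<le> n"
  shows "emeasure (\<Pi>\<^sub>M t\<in>{1..n}. drop_law m p) (run_box n k) = ennreal (p ^ k)"
proof -
  have "emeasure (\<Pi>\<^sub>M t\<in>{1..n}. drop_law m p) (run_box n k)
      = (\<Prod>t\<in>{1..n}. if t \<le> k then ennreal p else 1)"
    unfolding run_box_def using assms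
    by (subst emeasure_PiM_drop_law) (auto simp: emeasure_drop_law intro!: prod.cong)
  also have "\<dots> = (\<Prod>t\<in>{1..k}. ennreal p)"
    using assms by (intro prod.mono_neutral_cong_right) auto
  finally show ?thesis using assms by (simp add: ennreal_power)
qed

text \<open>Multiplying within each column \<open>i\<close> first gives the censored geometric law of the run in sample \<open>i\<close>.\<close>

lemma emeasure_sample_box:
  assumes p: "0 \<le> p" "p \<le> 1" and g: "g \<in> {1..K} \<rightarrow>\<^sub>E {0..n}"
  shows "emeasure (\<Pi>\<^sub>M q\<in>{1..n} \<times> {1..K}. drop_law m p) (sample_box n K g)
    = ennreal (\<Prod>i\<in>{1..K}. run_prob n p (g i))"
proof -
  define h where "h t a = (if t \<le> a then p else if t = Suc a then 1 - p else 1)" for t a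
  have column: "(\<Prod>t\<in>{1..n}. h t a) = run_prob n p a" if "a \<le> n" for n a
    using that
  proof (induction n)
    case (Suc n)
    show ?case
    proof (cases "a \<le> n")
      case True
      then show ?thesis using Suc.IH by (auto simp: run_prob_def h_def)
    next
      case False
      with Suc.prems have "a = Suc n" by simp
      then show ?thesis by (simp add: run_prob_def h_def)
    qed
  qed (simp add: run_prob_def)
  have "emeasure (\<Pi>\<^sub>M q\<in>{1..n} \<times> {1..K}. drop_law m p) (sample_box n K g)
      = (\<Prod>(t, i)\<in>{1..n} \<times> {1..K}. ennreal (h t (g i)))"
    unfolding sample_box_def using p
    by (subst emeasure_PiM_drop_law) (auto simp: emeasure_drop_law h_def intro!: prod.cong)
  also have "\<dots> = ennreal (\<Prod>(t, i)\<in>{1..n} \<times> {1..K}. h t (g i))"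
    using p by (subst prod_ennreal[symmetric]) (auto simp: h_def intro!: prod.cong)
  also have "(\<Prod>(t, i)\<in>{1..n} \<times> {1..K}. h t (g i)) = (\<Prod>i\<in>{1..K}. \<Prod>t\<in>{1..n}. h t (g i))"
    by (subst prod.cartesian_product[symmetric]) (rule prod.swap)
  also have "\<dots> = (\<Prod>i\<in>{1..K}. run_prob n p (g i))"
    using g by (intro prod.cong column) (auto dest: PiE_mem)
  finally show ?thesis .
qed

section \<open>Rewards and maxima of the rise-or-drop walk\<close>

text \<open>The sample data reveal the initial runs and nothing else, as the rewards are zero from the drop onwards.\<close>

lemma sample_box_cover:
  assumes y: "y \<in> space (\<Pi>\<^sub>M q\<in>{1..n} \<times> {1..K}. drop_law n p)"
    "\<And>q. q \<in> {1..n} \<times> {1..K} \<Longrightarrow> y q \<in> {1, - real n}"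
  obtains g where "g \<in> {1..K} \<rightarrow>\<^sub>E {0..n}" "y \<in> sample_box n K g"
    "sample_data n K y = run_data n K g"
proof -
  have "\<exists>a\<le>n. (\<forall>t\<in>{1..a}. y (t, i) = 1) \<and> (a < n \<longrightarrow> y (Suc a, i) \<noteq> 1)" for i
    by (rule initial_run[of n "\<lambda>t. y (t, i)"]) blast
  then obtain f where f: "\<And>i. f i \<le> n" "\<And>i t. t \<in> {1..f i} \<Longrightarrow> y (t, i) = 1"
    "\<And>i. f i < n \<Longrightarrow> y (Suc (f i), i) \<noteq> 1"
    by metis
  define g where "g = restrict f {1..K}"
  have "max 0 (walk (\<lambda>s. y (s, i)) t) = (if t \<le> g i then real t else 0)"
    if ti: "t \<in> {0..n}" "i \<in> {1..K}" for t i
  proof (cases "t \<le> g i")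
    case True
    then have "walk (\<lambda>s. y (s, i)) t = real t"
      using f(2) ti by (intro walk_up) (auto simp: g_def)
    with True show ?thesis by simp
  next
    case False
    then have "walk (\<lambda>s. y (s, i)) t \<le> 0"
      using y(2) f(3)[of i] ti
      by (intro walk_after_drop[where n = n and s = "Suc (g i)"]) (auto simp: g_def)
    with False show ?thesis by simp
  qed
  then have "sample_data n K y = run_data n K g"
    by (auto simp: sample_data_def run_data_def restrict_def)
  moreover have "y \<in> sample_box n K g"
    using y(1) f by (auto simp: sample_box_def space_PiM g_def PiE_iff)
  moreover have "g \<in> {1..K} \<rightarrow>\<^sub>E {0..n}"
    using f(1) by (auto simp: g_def)
  ultimately show thesis using that by blast
qed

text \<open>A positive reward at \<open>k\<close> means that no drop occurred until \<open>k\<close>, so all decisions up to then were made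
  on the rewards \<open>1, 2, \<dots>\<close>, and \<open>stop_event\<close> describes them.\<close>

lemma stopped_reward_cases:
  assumes x: "x \<in> space (\<Pi>\<^sub>M t\<in>{1..n}. drop_law n p)"
      "\<And>t. t \<in> {1..n} \<Longrightarrow> x t \<in> {1, - real n}"
    and u: "u \<in> space (uniform_draws n)"
  shows "stopped_reward x (stopping_index n r d x u) = 0 \<or>
    (\<exists>k\<in>{1..n}. x \<in> run_box n k \<and> u \<in> stop_event n r d k \<and>
       stopped_reward x (stopping_index n r d x u) = real k)"
proof (cases "stopping_index n r d x u")
  case infinity
  then show ?thesis by (simp add: stopped_reward_def)
next
  case (enat k)
  let ?S = "{k \<in> {1..n}. u k \<le> r k d (rewards k x)}"
  have "?S \<noteq> {}"
  proof
    assume "?S = {}"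
    with enat show False unfolding stopping_index_def by (simp only:) (simp add: Inf_enat_def)
  qed
  then obtain j where "enat j \<in> enat ` ?S" by blast
  then have "enat k \<in> enat ` ?S"
    using wellorder_InfI[of "enat j" "enat ` ?S"] enat unfolding stopping_index_def by simp
  then have k: "k \<in> {1..n}" "u k \<le> r k d (rewards k x)" by auto
  have before: "r s d (rewards s x) < u s" if "s \<in> {1..<k}" for s
  proof (rule ccontr)
    assume "\<not> r s d (rewards s x) < u s"
    then have "enat s \<in> enat ` ?S" using that k by auto
    then have "enat k \<le> enat s"
      using wellorder_Inf_le1[of "enat s" "enat ` ?S"] enat unfolding stopping_index_def by simp
    with that show False by simp
  qed
  show ?thesis
  proof (cases "\<forall>t\<in>{1..k}. x t = 1")
    case True
    then have walk: "walk x j = real j" if "j \<le> k" for j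
      using that by (intro walk_up) auto
    have rewards: "rewards j x = (\<lambda>i\<in>{1..j}. real i)" if "j \<le> k" for j
      using that by (auto simp: rewards_def walk restrict_def)
    have "u \<in> stop_event n r d k"
      using u k before by (auto simp: stop_event_def rewards)
    moreover have "x \<in> run_box n k"
      using x(1) True by (auto simp: run_box_def space_PiM PiE_iff)
    ultimately show ?thesis
      using k enat walk[of k] by (auto simp: stopped_reward_def)
  next
    case False
    then obtain s where "s \<in> {1..k}" "x s \<noteq> 1" by blast
    then have "walk x k \<le> 0"
      using k by (intro walk_after_drop[where n = n and s = s] x(2)) auto
    with enat show ?thesis by (simp add: stopped_reward_def)
  qed
qed

text \<open>Almost surely, the reward is dominated by a finite sum of multiples of indicators of products, one for
  each possible vector of sample runs and each stopping time. The three factors of such a product concern the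
  walk, the samples and the randomisation, which are independent, so the integral of the sum is explicit.\<close>

lemma expected_reward_drop_law_le:
  assumes p: "0 \<le> p" "p \<le> 1"
  shows "expected_reward n K r (drop_law n p) \<le>
    ennreal (\<Sum>g\<in>{1..K} \<rightarrow>\<^sub>E {0..n}. (\<Prod>i\<in>{1..K}. run_prob n p (g i)) *
      (\<Sum>k=1..n. measure (uniform_draws n) (stop_event n r (run_data n K g) k) * (real k * p ^ k)))"
proof -
  define G where "G = ({1..K} \<rightarrow>\<^sub>E {0..n})"
  define Q where "Q g k = run_box n k \<times> sample_box n K g \<times> stop_event n r (run_data n K g) k" for g k
  let ?J = "joint_law n K (drop_law n p)"
  let ?w = "\<lambda>g k. measure (uniform_draws n) (stop_event n r (run_data n K g) k)"
  interpret U: prob_space "uniform_draws n" by (rule prob_space_uniform_draws)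
  have fin: "finite G" by (auto simp: G_def intro: finite_PiE)
  have Q_sets: "Q g k \<in> sets ?J" if "k \<in> {1..n}" for g k
    unfolding Q_def
    by (intro emeasure_joint_law_Times(1) run_box_sets sample_box_sets stop_event_sets that)
  have "expected_reward n K r (drop_law n p)
      \<le> (\<integral>\<^sup>+z. (\<Sum>g\<in>G. \<Sum>k=1..n. ennreal (real k) * indicator (Q g k) z) \<partial>?J)"
    unfolding expected_reward_def
  proof (rule nn_integral_mono_AE)
    show "AE z in ?J. (case z of (x, y, u) \<Rightarrow>
        ennreal (stopped_reward x (stopping_index n r (sample_data n K y) x u)))
        \<le> (\<Sum>g\<in>G. \<Sum>k=1..n. ennreal (real k) * indicator (Q g k) z)"
      using AE_joint_law AE_space
    proof eventually_elim
      case (elim z)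
      obtain x y u where z: "z = (x, y, u)" by (cases z)
      from elim have x: "x \<in> space (\<Pi>\<^sub>M t\<in>{1..n}. drop_law n p)"
          "\<And>t. t \<in> {1..n} \<Longrightarrow> x t \<in> {1, - real n}"
        and y: "y \<in> space (\<Pi>\<^sub>M q\<in>{1..n} \<times> {1..K}. drop_law n p)"
          "\<And>q. q \<in> {1..n} \<times> {1..K} \<Longrightarrow> y q \<in> {1, - real n}"
        and u: "u \<in> space (uniform_draws n)"
        unfolding z joint_law_def space_pair_measure fst_conv snd_conv by blast+
      from y obtain g where g: "g \<in> G" "y \<in> sample_box n K g" "sample_data n K y = run_data n K g"
        unfolding G_def by (rule sample_box_cover)
      consider "stopped_reward x (stopping_index n r (run_data n K g) x u) = 0"
        | k where "k \<in> {1..n}" "x \<in> run_box n k" "u \<in> stop_event n r (run_data n K g) k"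
          "stopped_reward x (stopping_index n r (run_data n K g) x u) = real k"
        using stopped_reward_cases[OF x u] by blast
      then show ?case
      proof cases
        case 1
        then show ?thesis by (simp add: z g(3))
      next
        case (2 k)
        have "ennreal (real k) = ennreal (real k) * indicator (Q g k) z"
          using 2 g by (simp add: z Q_def)
        also have "\<dots> \<le> (\<Sum>k=1..n. ennreal (real k) * indicator (Q g k) z)"
          using 2(1) by (intro member_le_sum) auto
        also have "\<dots> \<le> (\<Sum>g\<in>G. \<Sum>k=1..n. ennreal (real k) * indicator (Q g k) z)"
          using g(1) fin by (intro member_le_sum[of g G "\<lambda>g. \<Sum>k=1..n. ennreal (real k) * indicator (Q g k) z"]) auto
        finally show ?thesis using 2(4) by (simp add: z g(3))
      qed
    qed
  qed
  also have "\<dots> = (\<Sum>g\<in>G. \<Sum>k=1..n. ennreal (real k) * emeasure ?J (Q g k))"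
  proof -
    have "(\<integral>\<^sup>+z. (\<Sum>k=1..n. ennreal (real k) * indicator (Q g k) z) \<partial>?J)
        = (\<Sum>k=1..n. ennreal (real k) * emeasure ?J (Q g k))" for g
      using Q_sets by (subst nn_integral_sum) (auto intro!: sum.cong nn_integral_cmult_indicator)
    moreover have "(\<lambda>z. \<Sum>k=1..n. ennreal (real k) * indicator (Q g k) z) \<in> borel_measurable ?J" for g
      using Q_sets by (intro borel_measurable_sum borel_measurable_times_ennreal) auto
    ultimately show ?thesis by (subst nn_integral_sum) auto
  qed
  also have "\<dots> = (\<Sum>g\<in>G. \<Sum>k=1..n. ennreal (real k * (p ^ k *
      ((\<Prod>i\<in>{1..K}. run_prob n p (g i)) * ?w g k))))"
  proof (intro sum.cong refl)
    fix g k assume g: "g \<in> G" and k: "k \<in> {1..n}"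
    have "emeasure ?J (Q g k) = ennreal (p ^ k) *
        (ennreal (\<Prod>i\<in>{1..K}. run_prob n p (g i)) * ennreal (?w g k))"
      unfolding Q_def
        emeasure_joint_law_Times(2)[OF run_box_sets sample_box_sets stop_event_sets[OF k]]
        emeasure_sample_box[OF p g[unfolded G_def]] U.emeasure_eq_measure
      using emeasure_run_box[OF p, of k n] k by simp
    then show "ennreal (real k) * emeasure ?J (Q g k)
        = ennreal (real k * (p ^ k * ((\<Prod>i\<in>{1..K}. run_prob n p (g i)) * ?w g k)))"
      using p by (simp add: ennreal_mult prod_nonneg run_prob_nonneg)
  qed
  also have "\<dots> = ennreal (\<Sum>g\<in>G. \<Sum>k=1..n. real k * (p ^ k *
      ((\<Prod>i\<in>{1..K}. run_prob n p (g i)) * ?w g k)))"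
    using p by (simp add: sum_ennreal sum_nonneg prod_nonneg run_prob_nonneg)
  also have "(\<Sum>g\<in>G. \<Sum>k=1..n. real k * (p ^ k * ((\<Prod>i\<in>{1..K}. run_prob n p (g i)) * ?w g k)))
      = (\<Sum>g\<in>G. (\<Prod>i\<in>{1..K}. run_prob n p (g i)) * (\<Sum>k=1..n. ?w g k * (real k * p ^ k)))"
    by (simp add: sum_distrib_left mult_ac)
  finally show ?thesis by (simp add: G_def)
qed

text \<open>The maximum is at least the length of the initial run, and the run reaches \<open>k\<close> with probability \<open>p\<^sup>k\<close>.\<close>

lemma expected_max_drop_law_ge:
  assumes p: "0 \<le> p" "p \<le> 1"
  shows "ennreal (\<Sum>k=1..n. p ^ k) \<le> expected_max n K (drop_law n p)"
proof -
  let ?J = "joint_law n K (drop_law n p)"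
  let ?Y = "space (\<Pi>\<^sub>M q\<in>{1..n} \<times> {1..K}. drop_law n p)"
  let ?U = "space (uniform_draws n)"
  define Q where "Q k = run_box n k \<times> ?Y \<times> ?U" for k
  interpret Y: prob_space "\<Pi>\<^sub>M q\<in>{1..n} \<times> {1..K}. drop_law n p"
    by (rule prob_space_PiM_drop_law)
  interpret U: prob_space "uniform_draws n"
    by (rule prob_space_uniform_draws)
  have Q_sets: "Q k \<in> sets ?J" for k
    unfolding Q_def by (intro emeasure_joint_law_Times(1) run_box_sets sets.top)
  have "emeasure ?J (Q k) = ennreal (p ^ k)" if "k \<in> {1..n}" for k
    unfolding Q_def emeasure_joint_law_Times(2)[OF run_box_sets sets.top sets.top]
      Y.emeasure_space_1 U.emeasure_space_1
    using emeasure_run_box[OF p, of k n] that by simp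
  then have "ennreal (\<Sum>k=1..n. p ^ k) = (\<Sum>k=1..n. emeasure ?J (Q k))"
    using p by (simp flip: sum_ennreal)
  also have "\<dots> = (\<integral>\<^sup>+z. (\<Sum>k=1..n. indicator (Q k) z) \<partial>?J)"
    using Q_sets by (simp add: nn_integral_sum)
  also have "\<dots> \<le> expected_max n K (drop_law n p)"
    unfolding expected_max_def
  proof (rule nn_integral_mono)
    fix z assume "z \<in> space ?J"
    obtain x y u where z: "z = (x, y, u)" by (cases z)
    obtain a where a: "a \<le> n" "\<And>t. t \<in> {1..a} \<Longrightarrow> x t = 1" "a < n \<Longrightarrow> x (Suc a) \<noteq> 1"
      by (rule initial_run[of n x]) blast
    have "k \<le> a" if "x \<in> run_box n k" "k \<in> {1..n}" for k
    proof (rule ccontr)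
      assume "\<not> k \<le> a"
      with that have "x (Suc a) = 1"
        unfolding run_box_def by (auto dest!: PiE_mem[where x = "Suc a"])
      with \<open>\<not> k \<le> a\<close> that a(3) show False by auto
    qed
    then have "(\<Sum>k=1..n. indicator (Q k) z :: ennreal) \<le> (\<Sum>k=1..n. if k \<le> a then 1 else 0)"
      by (intro sum_mono) (auto simp: z Q_def indicator_def)
    also have "\<dots> = (\<Sum>k=1..a. 1)"
      using a(1) by (intro sum.mono_neutral_cong_right) auto
    also have "\<dots> = ennreal (walk x a)"
      using walk_up[of a x] a(2) by (simp add: ennreal_of_nat_eq_real_of_nat)
    also have "\<dots> \<le> ennreal (MAX k\<in>{0..n}. walk x k)"
      using a(1) by (intro ennreal_leI Max_ge) auto
    finally show "(\<Sum>k=1..n. indicator (Q k) z)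
        \<le> (case z of (x, y, u) \<Rightarrow> ennreal (MAX k\<in>{0..n}. walk x k))"
      by (simp add: z)
  qed
  finally show ?thesis .
qed

lemma expected_max_drop_law_finite: "expected_max n K (drop_law n p) < \<infinity>"
proof -
  let ?J = "joint_law n K (drop_law n p)"
  have "expected_max n K (drop_law n p) \<le> (\<integral>\<^sup>+z. ennreal (real n) \<partial>?J)"
    unfolding expected_max_def
  proof (rule nn_integral_mono_AE)
    show "AE z in ?J. (case z of (x, y, u) \<Rightarrow> ennreal (MAX k\<in>{0..n}. walk x k)) \<le> ennreal (real n)"
      using AE_joint_law
    proof eventually_elim
      case (elim z)
      obtain x y u where z: "z = (x, y, u)" by (cases z)
      from elim have "(MAX k\<in>{0..n}. walk x k) \<le> real n"
        unfolding z by (intro Max.boundedI) (auto intro!: walk_le)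
      then show ?case by (simp add: z ennreal_leI)
    qed
  qed
  also have "\<dots> = ennreal (real n)"
    using prob_space.emeasure_space_1[OF prob_space_joint_law, of n K n p] by simp
  also have "\<dots> < \<infinity>" by simp
  finally show ?thesis .
qed

section \<open>The prophet constant\<close>

theorem theorem3:
  fixes n K :: nat
  assumes "1 \<le> K" and "2 * K\<^sup>2 \<le> n"
  shows "prophet_constant n K <
    ennreal ((real K / (real K + 1)) ^ (K + 1) + (6 + 6 * harm K) / harm n)"
proof -
  define \<gamma> where "\<gamma> = (real K / (real K + 1)) ^ (K + 1)"
  define R where "R = 1 + \<gamma> * (harm n + harm K) + harm K"
  have n: "1 \<le> n" using assms by (cases n) auto
  have harm_n: "(0 :: real) < harm n" using n by (intro harm_pos) auto
  have harm_K: "(0 :: real) \<le> harm K" by (rule harm_nonneg)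
  have \<gamma>: "0 \<le> \<gamma>" "\<gamma> \<le> 1"
    unfolding \<gamma>_def by (auto intro!: power_le_one simp del: power_Suc)
  have "prophet_constant n K \<le> ennreal (R / harm n)"
    unfolding prophet_constant_def
  proof (rule SUP_least)
    fix r assume "r \<in> stopping_rules n K"
    define c where "c = (INF F\<in>{F. real_distribution F \<and> 0 < expected_max n K F \<and>
        expected_max n K F < \<infinity>}. expected_reward n K r F / expected_max n K F)"
    define w where "w g k = measure (uniform_draws n) (stop_event n r (run_data n K g) k)" for g k
    define V where "V p = (\<Sum>g\<in>{1..K} \<rightarrow>\<^sub>E {0..n}. (\<Prod>i\<in>{1..K}. run_prob n p (g i)) *
      (\<Sum>k=1..n. w g k * (real k * p ^ k)))" for p
    have c_le: "c \<le> ennreal (V p / (\<Sum>k=1..n. p ^ k))" and pos: "0 < (\<Sum>k=1..n. p ^ k)"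
      and V: "0 \<le> V p" if p: "0 < p" "p < 1" for p
    proof -
      show pos: "0 < (\<Sum>k=1..n. p ^ k)"
        using n p by (intro sum_pos) auto
      show V: "0 \<le> V p"
        unfolding V_def w_def using p
        by (intro sum_nonneg mult_nonneg_nonneg prod_nonneg ballI run_prob_nonneg) auto
      have max: "ennreal (\<Sum>k=1..n. p ^ k) \<le> expected_max n K (drop_law n p)"
        using p by (intro expected_max_drop_law_ge) auto
      then have "0 < expected_max n K (drop_law n p)"
        using pos by (metis ennreal_less_zero_iff order_less_le_trans)
      then have "c \<le> expected_reward n K r (drop_law n p) / expected_max n K (drop_law n p)"
        unfolding c_def using real_distribution_drop_law expected_max_drop_law_finite
        by (intro INF_lower) auto
      also have "\<dots> \<le> ennreal (V p) / expected_max n K (drop_law n p)"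
        unfolding V_def w_def using p
        by (intro divide_right_mono_ennreal expected_reward_drop_law_le) auto
      also obtain m where m: "expected_max n K (drop_law n p) = ennreal m" "0 \<le> m"
        using expected_max_drop_law_finite[of n K p]
        by (cases "expected_max n K (drop_law n p)") auto
      have m_ge: "(\<Sum>k=1..n. p ^ k) \<le> m"
        using max m by (simp add: ennreal_le_iff)
      have "ennreal (V p) / expected_max n K (drop_law n p) = ennreal (V p / m)"
        unfolding m using pos V m_ge by (intro divide_ennreal) auto
      also have "\<dots> \<le> ennreal (V p / (\<Sum>k=1..n. p ^ k))"
        using pos V m_ge by (intro ennreal_leI divide_left_mono) auto
      finally show "c \<le> ennreal (V p / (\<Sum>k=1..n. p ^ k))" .
    qed
    \<comment> \<open>The infimum ranges over a nonempty set, which contains \<open>drop_law n (1/2)\<close>; so it is finite.\<close>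
    obtain c' where c': "c = ennreal c'" "0 \<le> c'"
    proof (cases c)
      case top
      with c_le[of "1/2"] show ?thesis by (simp add: top_unique)
    qed (use that in auto)
    have "c' * harm n \<le> R"
      unfolding R_def \<gamma>_def
    proof (rule average_ratio_le)
      fix p :: real assume p: "0 < p" "p < 1"
      have "c' \<le> V p / (\<Sum>k=1..n. p ^ k)"
        using c_le[OF p] pos[OF p] V[OF p] by (simp add: c' ennreal_le_iff)
      then show "c' * (\<Sum>k=1..n. p ^ k) \<le> (\<Sum>g\<in>{1..K} \<rightarrow>\<^sub>E {0..n}.
          (\<Prod>i\<in>{1..K}. run_prob n p (g i)) * (\<Sum>k=1..n. w g k * (real k * p ^ k)))"
        using pos[OF p] by (simp add: V_def pos_le_divide_eq)
    qed (use assms n sum_measure_stop_event_le in \<open>auto simp: w_def\<close>)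
    then have "c' \<le> R / harm n"
      using harm_n by (simp add: pos_le_divide_eq)
    then show "c \<le> ennreal (R / harm n)"
      by (simp add: c' ennreal_leI)
  qed
  also have "\<dots> < ennreal (\<gamma> + (6 + 6 * harm K) / harm n)"
  proof (rule ennreal_lessI)
    have "\<gamma> * harm K \<le> harm K"
      using \<gamma> harm_K by (simp add: mult_left_le_one_le)
    then have "R < \<gamma> * harm n + (6 + 6 * harm K)"
      using harm_K unfolding R_def by (simp add: algebra_simps)
    then have "R / harm n < (\<gamma> * harm n + (6 + 6 * harm K)) / harm n"
      using harm_n by (intro divide_strict_right_mono)
    then show "R / harm n < \<gamma> + (6 + 6 * harm K) / harm n"
      using harm_n by (simp add: add_divide_distrib)
    show "0 < \<gamma> + (6 + 6 * harm K) / harm n"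
      using \<gamma> harm_n harm_K by (intro add_nonneg_pos divide_pos_pos add_pos_nonneg) simp_all
  qed
  finally show ?thesis by (simp add: \<gamma>_def)
qed

end
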